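(* Let $(A,[-,-]_A,\omega,\beta)$ be a skew-symmetric quadratic Rota-Baxter Leibniz algebra of weight $0$. Then there is a triangular Leibniz bialgebra $(A,[-,-]_A,\Delta_r)$ with $\Delta_r(x)=F(x)r$ for $x\in A$, where $r\in A\otimes A$ is given through its operator form $T_r:A^*\to A$ by \[ T_r(a^* )=\beta\big((\omega^\sharp)^{-1}a^*\big),\qquad\forall a^*\in A^*. \]
   Context: All vector spaces and algebras are finite-dimensional over an algebraically closed field $\mathbb{K}$ of characteristic zero. A (left) Leibniz algebra is a vector space $A$ with a bilinear multiplication $[-,-]_A$ satisfying $[x,[y,z]_A]_A=[[x,y]_A,z]_A+[y,[x,z]_A]_A$. Define $\mathcal{L}_A(x)y=[x,y]_A=\mathcal{R}_A(y)x$, $\sigma(x\otimes y)=y\otimes x$, and $F(x)=(\mathcal{L}_A+\mathcal{R}_A)(x)\otimes\mathrm{id}-\mathrm{id}\otimes\mathcal{R}_A(x)\in\mathrm{End}(A\otimes A)$. A Leibniz bialgebra is a triple $(A,[-,-]_A,\Delta)$ where $(A,[-,-]_A)$ is a Leibniz algebra and $\Delta:A\to A\otimes A$ is linear with $(\Delta\otimes\mathrm{id})\Delta+(\sigma\otimes\mathrm{id})(\mathrm{id}\otimes\Delta)\Delta-(\mathrm{id}\otimes\Delta)\Delta=0$ and, for all $x,y\in A$, \[ \sigma(\mathcal{R}_A(y)\otimes\mathrm{id})\Delta(x)=(\mathcal{R}_A(x)\otimes\mathrm{id})\Delta(y), \] \[ \Delta([x,y]_A)=\big(\mathrm{id}\otimes\mathcal{R}_A(y)-(\mathcal{L}_A+\mathcal{R}_A)(y)\otimes\mathrm{id}\big)(\mathrm{id}+\sigma)\Delta(x)+\big(\mathrm{id}\otimes\mathcal{L}_A(x)+\mathcal{L}_A(x)\otimes\mathrm{id}\big)\Delta(y).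 \] For $r=\sum_i a_i\otimes b_i\in A\otimes A$ put $[[r,r]]=\sum_{i,j}\big([a_i,a_j]_A\otimes b_i\otimes b_j-a_i\otimes([b_i,a_j]_A+[a_j,b_i]_A)\otimes b_j+a_i\otimes a_j\otimes[b_j,b_i]_A\big)$; $r$ is a solution of the classical Leibniz Yang-Baxter equation (CLYBE) if $[[r,r]]=0$. A Leibniz bialgebra $(A,[-,-]_A,\Delta_r)$, $\Delta_r(x)=F(x)r$, is triangular if $r$ is a symmetric ($r=\sigma(r)$) solution of the CLYBE. The operator form $T_r:A^*\to A$ of $r$ is given by $\langle T_r(a^* ),b^*\rangle=\langle r,a^*\otimes b^*\rangle$. A skew-symmetric quadratic Leibniz algebra $(A,[-,-]_A,\omega)$ is a Leibniz algebra with a nondegenerate skew-symmetric bilinear form $\omega$ such that $\omega(x,[y,z]_A)=\omega([x,z]_A+[z,x]_A,y)$ for all $x,y,z\in A$. The isomorphism $\omega^\sharp:A\to A^*$ is given by $\omega(x,y)=\langle\omega^\sharp(x),y\rangle$. A Rota-Baxter operator of weight $\lambda$ on $(A,[-,-]_A)$ is a linear map $\beta:A\to A$ with $[\beta(x),\beta(y)]_A=\beta([x,\beta(y)]_A+[\beta(x),y]_A+\lambda[x,y]_A)$. A skew-symmetric quadratic Rota-Baxter Leibniz algebra of weight $\lambda$ is a quadruple $(A,[-,-]_A,\omega,\beta)$ with $(A,[-,-]_A,\omega)$ a skew-symmetric quadratic Leibniz algebra and $\beta$ a Rota-Baxter operator of weight $\lambda$ on $(A,[-,-]_A)$ such that $\omega(\beta(x),y)+\omega(x,\beta(y))+\lambda\omega(x,y)=0$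 for all $x,y\in A$. *)

theory Defs
  imports
    Complex_Main
    "HOL-Library.Function_Algebras"
    "HOL-Computational_Algebra.Polynomial"
begin

section \<open>Dual space and tensor powers\<close>

text \<open>
  The vector space \<open>A\<close> is a whole type \<open>'a\<close> with scalar multiplication \<open>s\<close>.  Its tensor powers
  are realised inside the multilinear forms on the dual: \<open>a \<otimes> b\<close> is the form
  \<open>(f, g) \<mapsto> f a * g b\<close> on \<open>A\<^sup>* \<times> A\<^sup>*\<close>, and \<open>A \<otimes> A\<close> is the set of finite sums of such forms, so that
  the pairing of \<open>t \<in> A \<otimes> A\<close> with \<open>f \<otimes> g\<close> is just \<open>t f g\<close>.  All forms are set to \<open>0\<close> outside the
  dual space, so that equality of tensors is equality of HOL functions.  The universal property is
  proved below.
\<close>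

definition dual :: "('k::field \<Rightarrow> 'a::ab_group_add \<Rightarrow> 'a) \<Rightarrow> ('a \<Rightarrow> 'k) set"
  where "dual s = {f. Vector_Spaces.linear s (*) f}"

type_synonym ('a, 'k) tensor2 = "('a \<Rightarrow> 'k) \<Rightarrow> ('a \<Rightarrow> 'k) \<Rightarrow> 'k"
type_synonym ('a, 'k) tensor3 = "('a \<Rightarrow> 'k) \<Rightarrow> ('a \<Rightarrow> 'k) \<Rightarrow> ('a \<Rightarrow> 'k) \<Rightarrow> 'k"

definition tens2 :: "('k::field \<Rightarrow> 'a::ab_group_add \<Rightarrow> 'a) \<Rightarrow> 'a \<Rightarrow> 'a \<Rightarrow> ('a, 'k) tensor2"
  where "tens2 s a b = (\<lambda>f g. if f \<in> dual s \<and> g \<in> dual s then f a * g b else 0)"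

definition tens3 :: "('k::field \<Rightarrow> 'a::ab_group_add \<Rightarrow> 'a) \<Rightarrow> 'a \<Rightarrow> 'a \<Rightarrow> 'a \<Rightarrow> ('a, 'k) tensor3"
  where "tens3 s a b c =
    (\<lambda>f g h. if f \<in> dual s \<and> g \<in> dual s \<and> h \<in> dual s then f a * g b * h c else 0)"

definition sum_tens2 :: "('k::field \<Rightarrow> 'a::ab_group_add \<Rightarrow> 'a) \<Rightarrow> ('a \<times> 'a) list \<Rightarrow> ('a, 'k) tensor2"
  where "sum_tens2 s xs = (\<Sum>(a, b)\<leftarrow>xs. tens2 s a b)"

definition tensor_square :: "('k::field \<Rightarrow> 'a::ab_group_add \<Rightarrow> 'a) \<Rightarrow> ('a, 'k) tensor2 set"
  where "tensor_square s = range (sum_tens2 s)"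

definition scale_tens2 :: "'k::field \<Rightarrow> ('a, 'k) tensor2 \<Rightarrow> ('a, 'k) tensor2"
  where "scale_tens2 c t = (\<lambda>f g. c * t f g)"

text \<open>
  The map \<open>\<phi> \<otimes> \<psi>\<close>, the flip \<open>\<sigma>\<close>, and the maps \<open>\<Delta> \<otimes> id\<close>, \<open>id \<otimes> \<Delta>\<close>, \<open>\<sigma> \<otimes> id\<close>, written through their
  transposes; lemmas below give their values on elementary tensors.
\<close>

definition map_tens2 ::
    "('k::field \<Rightarrow> 'a::ab_group_add \<Rightarrow> 'a) \<Rightarrow> ('a \<Rightarrow> 'a) \<Rightarrow> ('a \<Rightarrow> 'a) \<Rightarrow> ('a, 'k) tensor2 \<Rightarrow> ('a, 'k) tensor2"
  where "map_tens2 s \<phi> \<psi> t =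
    (\<lambda>f g. if f \<in> dual s \<and> g \<in> dual s then t (f \<circ> \<phi>) (g \<circ> \<psi>) else 0)"

definition flip :: "('a, 'k) tensor2 \<Rightarrow> ('a, 'k) tensor2"
  where "flip t = (\<lambda>f g. t g f)"

definition comul_id ::
    "('k::field \<Rightarrow> 'a::ab_group_add \<Rightarrow> 'a) \<Rightarrow> ('a \<Rightarrow> ('a, 'k) tensor2) \<Rightarrow> ('a, 'k) tensor2 \<Rightarrow> ('a, 'k) tensor3"
  where "comul_id s \<Delta> t =
    (\<lambda>f g h. if f \<in> dual s \<and> g \<in> dual s \<and> h \<in> dual s then t (\<lambda>x. \<Delta> x f g) h else 0)"

definition id_comul ::
    "('k::field \<Rightarrow> 'a::ab_group_add \<Rightarrow> 'a) \<Rightarrow> ('a \<Rightarrow> ('a, 'k) tensor2) \<Rightarrow> ('a, 'k) tensor2 \<Rightarrow> ('a, 'k) tensor3"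
  where "id_comul s \<Delta> t =
    (\<lambda>f g h. if f \<in> dual s \<and> g \<in> dual s \<and> h \<in> dual s then t f (\<lambda>x. \<Delta> x g h) else 0)"

definition flip_id :: "('a, 'k) tensor3 \<Rightarrow> ('a, 'k) tensor3"
  where "flip_id u = (\<lambda>f g h. u g f h)"

text \<open>The operator form \<open>T\<^sub>r : A\<^sup>* \<rightarrow> A\<close> of \<open>r\<close>.\<close>

definition operator_form ::
    "('k::field \<Rightarrow> 'a::ab_group_add \<Rightarrow> 'a) \<Rightarrow> ('a, 'k) tensor2 \<Rightarrow> ('a \<Rightarrow> 'k) \<Rightarrow> 'a"
  where "operator_form s r f = (THE x. \<forall>g\<in>dual s. g x = r f g)"

definition bilinear_map ::
    "('k::field \<Rightarrow> 'a::ab_group_add \<Rightarrow> 'a) \<Rightarrow> ('k \<Rightarrow> 'c::ab_group_add \<Rightarrow> 'c) \<Rightarrow> ('a \<Rightarrow> 'a \<Rightarrow> 'c) \<Rightarrow> bool"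
  where "bilinear_map s s' B \<longleftrightarrow>
    (\<forall>x. Vector_Spaces.linear s s' (B x)) \<and> (\<forall>y. Vector_Spaces.linear s s' (\<lambda>x. B x y))"


section \<open>Leibniz bialgebras and the classical Leibniz Yang-Baxter equation\<close>

definition F_op ::
    "('k::field \<Rightarrow> 'a::ab_group_add \<Rightarrow> 'a) \<Rightarrow> ('a \<Rightarrow> 'a \<Rightarrow> 'a) \<Rightarrow> 'a \<Rightarrow> ('a, 'k) tensor2 \<Rightarrow> ('a, 'k) tensor2"
  where "F_op s br x t =
    map_tens2 s (\<lambda>y. br x y + br y x) id t - map_tens2 s id (\<lambda>y. br y x) t"

definition coboundary ::
    "('k::field \<Rightarrow> 'a::ab_group_add \<Rightarrow> 'a) \<Rightarrow> ('a \<Rightarrow> 'a \<Rightarrow> 'a) \<Rightarrow> ('a, 'k) tensor2 \<Rightarrow> 'a \<Rightarrow> ('a, 'k) tensor2"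
  where "coboundary s br r = (\<lambda>x. F_op s br x r)"

definition double_bracket_sum ::
    "('k::field \<Rightarrow> 'a::ab_group_add \<Rightarrow> 'a) \<Rightarrow> ('a \<Rightarrow> 'a \<Rightarrow> 'a) \<Rightarrow> ('a \<times> 'a) list \<Rightarrow> ('a, 'k) tensor3"
  where "double_bracket_sum s br xs =
    (\<Sum>(a, b)\<leftarrow>xs. \<Sum>(a', b')\<leftarrow>xs.
      tens3 s (br a a') b b' - tens3 s a (br b a' + br a' b) b' + tens3 s a a' (br b' b))"

text \<open>
  \<open>[[r, r]]\<close> is computed from any presentation of \<open>r\<close> as a finite sum of elementary tensors; see
  \<open>double_bracket_eq\<close> for the independence of the choice.
\<close>

definition double_bracket ::
    "('k::field \<Rightarrow> 'a::ab_group_add \<Rightarrow> 'a) \<Rightarrow> ('a \<Rightarrow> 'a \<Rightarrow> 'a) \<Rightarrow> ('a, 'k) tensor2 \<Rightarrow> ('a, 'k) tensor3"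
  where "double_bracket s br r = double_bracket_sum s br (SOME xs. sum_tens2 s xs = r)"

locale leibniz_algebra = finite_dimensional_vector_space s Basis
  for s :: "'k::{alg_closed_field, field_char_0} \<Rightarrow> 'a::ab_group_add \<Rightarrow> 'a" and Basis :: "'a set" +
  fixes br :: "'a \<Rightarrow> 'a \<Rightarrow> 'a"
  assumes bilinear_br: "bilinear_map s s br"
    and leibniz: "br x (br y z) = br (br x y) z + br y (br x z)"

locale leibniz_bialgebra = leibniz_algebra s Basis br
  for s :: "'k::{alg_closed_field, field_char_0} \<Rightarrow> 'a::ab_group_add \<Rightarrow> 'a"
    and Basis :: "'a set" and br :: "'a \<Rightarrow> 'a \<Rightarrow> 'a" +
  fixes \<Delta> :: "'a \<Rightarrow> ('a, 'k) tensor2"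
  assumes comul_closed: "\<Delta> x \<in> tensor_square s"
    and comul_linear: "Vector_Spaces.linear s scale_tens2 \<Delta>"
    and co_leibniz:
      "comul_id s \<Delta> (\<Delta> x) + flip_id (id_comul s \<Delta> (\<Delta> x)) - id_comul s \<Delta> (\<Delta> x) = 0"
    and compat1:
      "flip (map_tens2 s (\<lambda>z. br z y) id (\<Delta> x)) = map_tens2 s (\<lambda>z. br z x) id (\<Delta> y)"
    and compat2:
      "\<Delta> (br x y) =
        map_tens2 s id (\<lambda>z. br z y) (\<Delta> x + flip (\<Delta> x))
        - map_tens2 s (\<lambda>z. br y z + br z y) id (\<Delta> x + flip (\<Delta> x))
        + (map_tens2 s id (br x) (\<Delta> y) + map_tens2 s (br x) id (\<Delta> y))"

locale triangular_leibniz_bialgebra = leibniz_bialgebra s Basis br "coboundary s br r"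
  for s :: "'k::{alg_closed_field, field_char_0} \<Rightarrow> 'a::ab_group_add \<Rightarrow> 'a"
    and Basis :: "'a set" and br :: "'a \<Rightarrow> 'a \<Rightarrow> 'a" and r :: "('a, 'k) tensor2" +
  assumes r_tensor: "r \<in> tensor_square s"
    and r_symmetric: "flip r = r"
    and r_clybe: "double_bracket s br r = 0"


section \<open>Skew-symmetric quadratic Rota-Baxter Leibniz algebras\<close>

locale skew_quadratic_leibniz_algebra = leibniz_algebra s Basis br
  for s :: "'k::{alg_closed_field, field_char_0} \<Rightarrow> 'a::ab_group_add \<Rightarrow> 'a"
    and Basis :: "'a set" and br :: "'a \<Rightarrow> 'a \<Rightarrow> 'a" +
  fixes \<omega> :: "'a \<Rightarrow> 'a \<Rightarrow> 'k"
  assumes bilinear_form: "bilinear_map s (*) \<omega>"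
    and nondegenerate: "(\<forall>y. \<omega> x y = 0) \<Longrightarrow> x = 0"
    and skew: "\<omega> x y = - \<omega> y x"
    and invariant: "\<omega> x (br y z) = \<omega> (br x z + br z x) y"

definition rota_baxter_operator ::
    "('k::field \<Rightarrow> 'a::ab_group_add \<Rightarrow> 'a) \<Rightarrow> ('a \<Rightarrow> 'a \<Rightarrow> 'a) \<Rightarrow> 'k \<Rightarrow> ('a \<Rightarrow> 'a) \<Rightarrow> bool"
  where "rota_baxter_operator s br lam \<beta> \<longleftrightarrow>
    Vector_Spaces.linear s s \<beta> \<and>
    (\<forall>x y. br (\<beta> x) (\<beta> y) = \<beta> (br x (\<beta> y) + br (\<beta> x) y + s lam (br x y)))"

locale skew_quadratic_rota_baxter_leibniz_algebra = skew_quadratic_leibniz_algebra s Basis br \<omega>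
  for s :: "'k::{alg_closed_field, field_char_0} \<Rightarrow> 'a::ab_group_add \<Rightarrow> 'a"
    and Basis :: "'a set" and br :: "'a \<Rightarrow> 'a \<Rightarrow> 'a" and \<omega> :: "'a \<Rightarrow> 'a \<Rightarrow> 'k" +
  fixes \<beta> :: "'a \<Rightarrow> 'a" and lam :: 'k
  assumes rota_baxter: "rota_baxter_operator s br lam \<beta>"
    and form_compat: "\<omega> (\<beta> x) y + \<omega> x (\<beta> y) + lam * \<omega> x y = 0"

text \<open>
  \<open>\<omega>\<^sup>\<sharp> : A \<rightarrow> A\<^sup>*\<close>.  When \<open>\<omega>\<close> is nondegenerate it is a bijection onto the dual, so its inverse on
  \<open>A\<^sup>*\<close> is \<open>inv (sharp \<omega>)\<close>.
\<close>

definition sharp :: "('a \<Rightarrow> 'a \<Rightarrow> 'k) \<Rightarrow> 'a \<Rightarrow> ('a \<Rightarrow> 'k)"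
  where "sharp \<omega> x = (\<lambda>y. \<omega> x y)"

section \<open>Consistency of the tensor encodings\<close>

lemma sum_list_fun_apply: "(\<Sum>x\<leftarrow>xs. F x) f = (\<Sum>x\<leftarrow>xs. F x f)"
  by (induction xs) auto

lemma sum_list_pair_fun_apply: "(\<Sum>(a, b)\<leftarrow>xs. F a b) f = (\<Sum>(a, b)\<leftarrow>xs. F a b f)"
  by (induction xs) auto

lemma sum_list_pair_0: "(\<Sum>(a, b)\<leftarrow>xs. 0) = 0"
  by (induction xs) auto

lemma sum_tens2_apply:
  assumes "f \<in> dual s" "g \<in> dual s"
  shows "sum_tens2 s xs f g = (\<Sum>(a, b)\<leftarrow>xs. f a * g b)"
  unfolding sum_tens2_def using assms by (induction xs) (auto simp: tens2_def)

lemma vector_space_field: "vector_space ((*) :: 'k::field \<Rightarrow> 'k \<Rightarrow> 'k)"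
  by unfold_locales (simp_all add: algebra_simps)

lemma dual_add: "f \<in> dual s \<Longrightarrow> f (x + y) = f x + f y"
  unfolding dual_def by (auto simp: Vector_Spaces.linear_iff)

lemma dual_scale: "f \<in> dual s \<Longrightarrow> f (s c x) = c * f x"
  unfolding dual_def by (auto simp: Vector_Spaces.linear_iff)

lemma bilinear_mapI:
  assumes "vector_space s" "vector_space s'"
    and "\<And>x y z. B (x + y) z = B x z + B y z" "\<And>x y z. B x (y + z) = B x y + B x z"
    and "\<And>c x y. B (s c x) y = s' c (B x y)" "\<And>c x y. B x (s c y) = s' c (B x y)"
  shows "bilinear_map s s' B"
  using assms unfolding bilinear_map_def Vector_Spaces.linear_iff by auto

lemma vector_space_scale_tens2: "vector_space scale_tens2"
  by unfold_locales (auto simp: scale_tens2_def fun_eq_iff algebra_simps)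

context finite_dimensional_vector_space
begin

lemma coordinate_in_dual:
  assumes "b \<in> Basis"
  shows "(\<lambda>x. representation Basis x b) \<in> dual scale"
  unfolding dual_def Vector_Spaces.linear_iff
  using independent_Basis span_Basis
  by (auto simp: representation_add representation_scale vector_space_axioms
      vector_space_field)

lemma dual_separates:
  assumes "\<And>g. g \<in> dual scale \<Longrightarrow> g x = g y"
  shows "x = y"
proof -
  have "representation Basis x b = representation Basis y b" if "b \<in> Basis" for b
    using assms[OF coordinate_in_dual[OF that]] .
  then have "(\<Sum>b\<in>Basis. scale (representation Basis x b) b)
      = (\<Sum>b\<in>Basis. scale (representation Basis y b) b)"
    by simp
  then show ?thesis
    using sum_representation_eq[OF independent_Basis _ finite_Basis order_refl] span_Basis
    by (metis UNIV_I)
qed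

lemma bilinear_tens2: "bilinear_map scale scale_tens2 (tens2 scale)"
  by (rule bilinear_mapI)
    (auto simp: vector_space_axioms vector_space_scale_tens2 tens2_def scale_tens2_def fun_eq_iff
      dual_add dual_scale algebra_simps)

text \<open>Universal property: together with \<open>bilinear_tens2\<close>, every bilinear map factors through
  \<open>tensor_square\<close>; uniqueness of the factorisation is clear since elementary tensors span.\<close>

lemma tensor_universal:
  assumes B: "bilinear_map scale s' B" and eq: "sum_tens2 scale xs = sum_tens2 scale ys"
  shows "(\<Sum>(a, b)\<leftarrow>xs. B a b) = (\<Sum>(a, b)\<leftarrow>ys. B a b)"
proof -
  define e where "e = (\<lambda>u x. representation Basis x u)"
  have lin1: "Vector_Spaces.linear scale s' (B x)"
    and lin2: "Vector_Spaces.linear scale s' (\<lambda>x. B x y)" for x y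
    using B by (auto simp: bilinear_map_def)
  interpret V: vector_space s' using lin1[of 0] by (simp add: Vector_Spaces.linear_iff)
  have expand: "x = (\<Sum>u\<in>Basis. scale (e u x) u)" for x
    using sum_representation_eq[OF independent_Basis _ finite_Basis order_refl, of x] span_Basis
    by (simp add: e_def)
  have e_dual: "e u \<in> dual scale" if "u \<in> Basis" for u
    using coordinate_in_dual[OF that] by (simp add: e_def)
  have B0: "B 0 y = 0" "B x 0 = 0" for x y
    using lin1[of x] lin2[of y] V.scale_zero_left scale_zero_left
    unfolding Vector_Spaces.linear_iff by metis+
  have Bsum1: "B (\<Sum>u\<in>S. scale (c u) u) y = (\<Sum>u\<in>S. s' (c u) (B u y))" if "finite S" for S c y
    using that
    by (induction S) (use lin2[of y] in \<open>simp_all add: Vector_Spaces.linear_iff B0\<close>)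
  have Bsum2: "B x (\<Sum>u\<in>S. scale (c u) u) = (\<Sum>u\<in>S. s' (c u) (B x u))" if "finite S" for S c x
    using that
    by (induction S) (use lin1[of x] in \<open>simp_all add: Vector_Spaces.linear_iff B0\<close>)
  have BB: "B a b = (\<Sum>u\<in>Basis. \<Sum>v\<in>Basis. s' (e u a * e v b) (B u v))" for a b
  proof -
    have "B a b = B (\<Sum>u\<in>Basis. scale (e u a) u) (\<Sum>v\<in>Basis. scale (e v b) v)"
      using expand by metis
    also have "\<dots> = (\<Sum>u\<in>Basis. s' (e u a) (\<Sum>v\<in>Basis. s' (e v b) (B u v)))"
      by (subst Bsum1[OF finite_Basis], subst Bsum2[OF finite_Basis]) (rule refl)
    finally show ?thesis by (simp add: V.scale_sum_right)
  qed
  have key: "(\<Sum>(a, b)\<leftarrow>zs. B a b)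
      = (\<Sum>u\<in>Basis. \<Sum>v\<in>Basis. s' (sum_tens2 scale zs (e u) (e v)) (B u v))" for zs
  proof -
    have "(\<Sum>(a, b)\<leftarrow>zs. B a b)
      = (\<Sum>u\<in>Basis. \<Sum>v\<in>Basis. s' (\<Sum>(a, b)\<leftarrow>zs. e u a * e v b) (B u v))"
    proof (induction zs)
      case (Cons z zs)
      obtain a b where "z = (a, b)" by (cases z)
      then show ?case
        using Cons by (simp add: V.scale_left_distrib sum.distrib BB[of a b])
    qed simp
    also have "\<dots> = (\<Sum>u\<in>Basis. \<Sum>v\<in>Basis. s' (sum_tens2 scale zs (e u) (e v)) (B u v))"
      by (intro sum.cong refl) (simp add: sum_tens2_apply e_dual)
    finally show ?thesis .
  qed
  show ?thesis unfolding key eq ..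
qed

lemma dual_comp_linear: "Vector_Spaces.linear scale scale \<phi> \<Longrightarrow> f \<in> dual scale \<Longrightarrow> f \<circ> \<phi> \<in> dual scale"
  unfolding dual_def Vector_Spaces.linear_iff by auto

lemma map_tens2_sum_tens2:
  assumes "Vector_Spaces.linear scale scale \<phi>" "Vector_Spaces.linear scale scale \<psi>"
  shows "map_tens2 scale \<phi> \<psi> (sum_tens2 scale xs) = (\<Sum>(a, b)\<leftarrow>xs. tens2 scale (\<phi> a) (\<psi> b))"
proof (intro ext)
  fix f g
  show "map_tens2 scale \<phi> \<psi> (sum_tens2 scale xs) f g = (\<Sum>(a, b)\<leftarrow>xs. tens2 scale (\<phi> a) (\<psi> b)) f g"
  proof (cases "f \<in> dual scale \<and> g \<in> dual scale")
    case True
    then show ?thesis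
      by (simp add: map_tens2_def sum_tens2_apply dual_comp_linear assms sum_list_pair_fun_apply)
        (simp add: tens2_def)
  next
    case False
    then have "tens2 scale a b f g = 0" for a b by (auto simp: tens2_def)
    with False show ?thesis
      by (auto simp: map_tens2_def sum_list_pair_fun_apply sum_list_pair_0)
  qed
qed

lemma flip_sum_tens2: "flip (sum_tens2 scale xs) = (\<Sum>(a, b)\<leftarrow>xs. tens2 scale b a)"
  unfolding sum_tens2_def
  by (induction xs) (auto simp: flip_def tens2_def fun_eq_iff)

lemma flip_id_tens3: "flip_id (tens3 scale a b c) = tens3 scale b a c"
  by (auto simp: flip_id_def tens3_def fun_eq_iff)

lemma tensor_square_outside:
  assumes "t \<in> tensor_square scale" "f \<notin> dual scale \<or> g \<notin> dual scale"
  shows "t f g = 0"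
proof -
  obtain xs where "t = sum_tens2 scale xs" using assms(1) by (auto simp: tensor_square_def)
  moreover have "tens2 scale a b f g = 0" for a b using assms(2) by (auto simp: tens2_def)
  ultimately show ?thesis
    by (simp add: sum_tens2_def sum_list_pair_fun_apply sum_list_pair_0)
qed

text \<open>\<open>(\<Delta> \<otimes> id)(a \<otimes> b) = \<Delta> a \<otimes> b\<close> and \<open>(id \<otimes> \<Delta>)(a \<otimes> b) = a \<otimes> \<Delta> b\<close>, evaluated on \<open>A\<^sup>* \<times> A\<^sup>* \<times> A\<^sup>*\<close>.\<close>

lemma comul_sum_tens2:
  assumes \<Delta>: "Vector_Spaces.linear scale scale_tens2 \<Delta>"
    and dual: "f \<in> dual scale" "g \<in> dual scale" "h \<in> dual scale"
  shows "comul_id scale \<Delta> (sum_tens2 scale xs) f g h = (\<Sum>(a, b)\<leftarrow>xs. \<Delta> a f g * h b)"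
    and "id_comul scale \<Delta> (sum_tens2 scale xs) f g h = (\<Sum>(a, b)\<leftarrow>xs. f a * \<Delta> b g h)"
proof -
  have "(\<lambda>x. \<Delta> x f' g') \<in> dual scale" for f' g'
    using \<Delta> unfolding dual_def Vector_Spaces.linear_iff
    by (auto simp: scale_tens2_def vector_space_field)
  with dual show "comul_id scale \<Delta> (sum_tens2 scale xs) f g h = (\<Sum>(a, b)\<leftarrow>xs. \<Delta> a f g * h b)"
    and "id_comul scale \<Delta> (sum_tens2 scale xs) f g h = (\<Sum>(a, b)\<leftarrow>xs. f a * \<Delta> b g h)"
    by (auto simp: comul_id_def id_comul_def sum_tens2_apply)
qed

lemma operator_form_eq:
  assumes r: "r = sum_tens2 scale xs" and f: "f \<in> dual scale"
  shows "operator_form scale r f = (\<Sum>(a, b)\<leftarrow>xs. scale (f a) b)"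
    and "\<forall>g\<in>dual scale. g (operator_form scale r f) = r f g"
proof -
  let ?x = "\<Sum>(a, b)\<leftarrow>xs. scale (f a) b"
  have g: "g ?x = r f g" if "g \<in> dual scale" for g
  proof -
    have "g 0 = 0" using dual_scale[OF that, of 0 0] by simp
    then have "g (\<Sum>(a, b)\<leftarrow>ys. scale (f a) b) = (\<Sum>(a, b)\<leftarrow>ys. f a * g b)" for ys
      by (induction ys) (auto simp: dual_add[OF that] dual_scale[OF that])
    then show ?thesis by (simp add: r sum_tens2_apply f that)
  qed
  show eq: "operator_form scale r f = ?x"
    unfolding operator_form_def
  proof (rule the_equality)
    show "\<forall>g\<in>dual scale. g ?x = r f g" using g by blast
    show "x = ?x" if "\<forall>g\<in>dual scale. g x = r f g" for x
      by (rule dual_separates) (simp add: that g)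
  qed
  show "\<forall>g\<in>dual scale. g (operator_form scale r f) = r f g"
    unfolding eq using g by blast
qed

text \<open>A tensor is determined by its operator form.\<close>

lemma operator_form_inject:
  assumes "r \<in> tensor_square scale" "r' \<in> tensor_square scale"
    and "\<forall>f\<in>dual scale. operator_form scale r f = operator_form scale r' f"
  shows "r = r'"
proof (intro ext)
  fix f g
  show "r f g = r' f g"
  proof (cases "f \<in> dual scale \<and> g \<in> dual scale")
    case True
    obtain xs ys where "r = sum_tens2 scale xs" "r' = sum_tens2 scale ys"
      using assms by (auto simp: tensor_square_def)
    with True assms(3) show ?thesis using operator_form_eq(2) by metis
  next
    case False
    then show ?thesis using assms tensor_square_outside by metis
  qed
qed

lemma double_bracket_eq:
  assumes br: "bilinear_map scale scale br" and r: "r = sum_tens2 scale xs"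
  shows "double_bracket scale br r = double_bracket_sum scale br xs"
proof -
  define K where "K = (\<lambda>f g h a b a' b'. f (br a a') * g b * h b'
    - f a * g (br b a' + br a' b) * h b' + f a * g a' * h (br b' b) :: 'a)"
  have add: "br (x + y) z = br x z + br y z" "br x (y + z) = br x y + br x z"
    and scl: "br (scale c x) y = scale c (br x y)" "br x (scale c y) = scale c (br x y)" for c x y z
    using br by (auto simp: bilinear_map_def Vector_Spaces.linear_iff)
  have eval: "double_bracket_sum scale br zs f g h
      = (\<Sum>(a, b)\<leftarrow>zs. \<Sum>(a', b')\<leftarrow>zs. K f g h a b a' b')"
    if "f \<in> dual scale" "g \<in> dual scale" "h \<in> dual scale" for zs f g h
    unfolding double_bracket_sum_def sum_list_pair_fun_apply
    using that by (simp add: tens3_def K_def)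
  have outside: "double_bracket_sum scale br zs f g h = 0"
    if "\<not> (f \<in> dual scale \<and> g \<in> dual scale \<and> h \<in> dual scale)" for zs f g h
  proof -
    have "tens3 scale a b c f g h = 0" for a b c using that by (auto simp: tens3_def)
    then show ?thesis
      by (simp add: double_bracket_sum_def sum_list_pair_fun_apply sum_list_pair_0)
  qed
  have main: "double_bracket_sum scale br xs = double_bracket_sum scale br ys"
    if eq: "sum_tens2 scale xs = sum_tens2 scale ys" for xs ys
  proof (intro ext)
    fix f g h
    show "double_bracket_sum scale br xs f g h = double_bracket_sum scale br ys f g h"
    proof (cases "f \<in> dual scale \<and> g \<in> dual scale \<and> h \<in> dual scale")
      case True
      note d = dual_add[of f scale] dual_add[of g scale] dual_add[of h scale]
        dual_scale[of f scale] dual_scale[of g scale] dual_scale[of h scale]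
      have inner: "bilinear_map scale (*) (\<lambda>a' b'. K f g h a b a' b')" for a b
        by (rule bilinear_mapI)
          (use True in \<open>auto simp: vector_space_axioms vector_space_field
             K_def add scl d algebra_simps\<close>)
      have outer: "bilinear_map scale (*) (\<lambda>a b. K f g h a b a' b')" for a' b'
        by (rule bilinear_mapI)
          (use True in \<open>auto simp: vector_space_axioms vector_space_field
             K_def add scl d algebra_simps\<close>)
      have sum_add: "(\<Sum>(a', b')\<leftarrow>zs. P a' b' + Q a' b')
          = (\<Sum>(a', b')\<leftarrow>zs. P a' b') + (\<Sum>(a', b')\<leftarrow>zs. Q a' b' :: 'a)" for zs P Q
        by (induction zs) auto
      have sum_scl: "(\<Sum>(a', b')\<leftarrow>zs. c * P a' b') = c * (\<Sum>(a', b')\<leftarrow>zs. P a' b' :: 'a)" for zs P c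
        by (induction zs) (auto simp: algebra_simps)
      have outer': "bilinear_map scale (*) (\<lambda>a b. \<Sum>(a', b')\<leftarrow>zs. K f g h a b a' b')" for zs
        by (rule bilinear_mapI, fact vector_space_axioms,
            fact vector_space_field)
          (use outer in \<open>simp_all add: bilinear_map_def Vector_Spaces.linear_iff sum_add sum_scl\<close>)
      have "double_bracket_sum scale br xs f g h
          = (\<Sum>(a, b)\<leftarrow>xs. \<Sum>(a', b')\<leftarrow>ys. K f g h a b a' b')"
        using tensor_universal[OF inner eq] True by (simp add: eval)
      also have "\<dots> = double_bracket_sum scale br ys f g h"
        using tensor_universal[OF outer' eq] True by (simp add: eval)
      finally show ?thesis .
    qed (simp add: outside)
  qed
  have "sum_tens2 scale (SOME xs. sum_tens2 scale xs = r) = r"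
    by (rule someI[of _ xs]) (simp add: r)
  then show ?thesis
    unfolding double_bracket_def by (intro main) (simp add: r)
qed

end

text \<open>\<open>\<omega>\<^sup>\<sharp>\<close> is a bijection from \<open>A\<close> onto its dual.\<close>

context skew_quadratic_leibniz_algebra
begin

lemma bij_sharp: "bij_betw (sharp \<omega>) UNIV (dual s)"
proof -
  have add: "\<omega> (x + y) z = \<omega> x z + \<omega> y z" "\<omega> x (y + z) = \<omega> x y + \<omega> x z"
    and scl: "\<omega> (s c x) y = c * \<omega> x y" "\<omega> x (s c y) = c * \<omega> x y" for c x y z
    using bilinear_form by (auto simp: bilinear_map_def Vector_Spaces.linear_iff)
  define D where "D = (\<lambda>x. \<Sum>b\<in>Basis. s (\<omega> x b) b)"
  have D_lin: "Vector_Spaces.linear s s D"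
    unfolding Vector_Spaces.linear_iff D_def
    by (simp add: vector_space_axioms add scl scale_left_distrib sum.distrib scale_sum_right)
  have on_basis: "f = g" if "f \<in> dual s" "g \<in> dual s" "\<And>b. b \<in> Basis \<Longrightarrow> f b = g b" for f g
  proof
    fix x
    have zero: "f 0 = 0" "g 0 = 0" using that dual_scale[of f s 0 0] dual_scale[of g s 0 0] by auto
    have lin: "f (\<Sum>b\<in>S. s (c b) b) = (\<Sum>b\<in>S. c b * f b) \<and>
      g (\<Sum>b\<in>S. s (c b) b) = (\<Sum>b\<in>S. c b * g b)" if "finite S" for S c
      using \<open>finite S\<close> \<open>f \<in> dual s\<close> \<open>g \<in> dual s\<close>
      by (induction S rule: finite_induct) (auto simp: zero dual_add dual_scale)
    have "f (\<Sum>b\<in>Basis. s (representation Basis x b) b)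
        = g (\<Sum>b\<in>Basis. s (representation Basis x b) b)"
      by (simp add: lin finite_Basis that(3) cong: sum.cong)
    then show "f x = g x"
      using sum_representation_eq[OF independent_Basis _ finite_Basis order_refl, of x] span_Basis
      by simp
  qed
  have sharp_dual: "sharp \<omega> x \<in> dual s" for x
    using bilinear_form by (simp add: sharp_def dual_def bilinear_map_def)
  have coeff: "\<omega> x b = c b" if "D x = (\<Sum>b\<in>Basis. s (c b) b)" "b \<in> Basis" for x b c
  proof -
    have "(\<Sum>b\<in>Basis. s (\<omega> x b - c b) b) = 0"
      using that(1) by (simp add: D_def scale_left_diff_distrib sum_subtractf)
    then have "\<omega> x b - c b = 0"
      using independentD[OF independent_Basis finite_Basis order_refl, of "\<lambda>b. \<omega> x b - c b"]
        that(2) by blast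
    then show ?thesis by simp
  qed
  have inj: "inj D"
  proof (rule injI)
    fix x y
    assume "D x = D y"
    then have "\<omega> x b = \<omega> y b" if "b \<in> Basis" for b
      using coeff[of x "\<omega> y" b] that by (simp add: D_def)
    then have "sharp \<omega> x = sharp \<omega> y"
      by (intro on_basis[OF sharp_dual sharp_dual]) (simp add: sharp_def)
    then have "\<omega> x z = \<omega> y z" for z by (simp add: sharp_def fun_eq_iff)
    then have "\<omega> (x - y) z = 0" for z using add(1)[of "x - y" y z] by simp
    then have "x - y = 0" by (rule nondegenerate[OF allI])
    then show "x = y" by simp
  qed
  then have "surj D" using D_lin linear_inj_imp_surj by blast
  show ?thesis
  proof (rule bij_betw_imageI)
    show "inj (sharp \<omega>)"
    proof (rule injI)
      fix x y
      assume "sharp \<omega> x = sharp \<omega> y"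
      then have "D x = D y" by (simp add: D_def sharp_def fun_eq_iff)
      then show "x = y" by (rule injD[OF inj])
    qed
    show "range (sharp \<omega>) = dual s"
    proof (intro subset_antisym subsetI)
      fix f assume f: "f \<in> dual s"
      obtain x where "D x = (\<Sum>b\<in>Basis. s (f b) b)" using surjD[OF \<open>surj D\<close>] by metis
      then have "sharp \<omega> x = f"
        using coeff[of x f] by (intro on_basis[OF sharp_dual f]) (auto simp: sharp_def)
      then show "f \<in> range (sharp \<omega>)" by blast
    qed (use sharp_dual in auto)
  qed
qed

end

end

theory Submission
  imports Defs
begin

text \<open>
  Identify \<open>A\<^sup>*\<close> with \<open>A\<close> through \<open>\<omega>\<^sup>\<sharp>\<close>.  Invariance turns the transposes of \<open>L(x)\<close> and \<open>R(x)\<close> into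
  \<open>u \<mapsto> - [x, u]\<close> and \<open>u \<mapsto> [u, x] + [x, u]\<close>, and then \<open>\<Delta>\<^sub>r(x)\<close> becomes the form \<open>(u, v) \<mapsto> \<omega>(u * v, x)\<close>
  with \<open>u * v = [\<beta> u, v] + [u, \<beta> v]\<close>.  The co-Leibniz identity is thus the Leibniz identity of the
  descendent product \<open>*\<close>, the CLYBE is the Rota-Baxter identity, and the two compatibility
  conditions follow from the Leibniz identity of \<open>A\<close> and the skewness of \<open>\<beta>\<close>.
\<close>

section \<open>Closure of the tensor square, and tensors with a prescribed operator form\<close>

context finite_dimensional_vector_space
begin

lemma tensor_square_diff:
  assumes "t \<in> tensor_square scale" "t' \<in> tensor_square scale"
  shows "t - t' \<in> tensor_square scale"
proof -
  obtain xs ys where t: "t = sum_tens2 scale xs" and t': "t' = sum_tens2 scale ys"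
    using assms by (auto simp: tensor_square_def)
  have neg: "g (- a) = - g a" if "g \<in> dual scale" for g a
    using dual_scale[OF that, of "- 1" a] by simp
  \<comment> \<open>The sign is absorbed into the first factors, so a difference of presentations is
    again one list.\<close>
  have "sum_tens2 scale (map (\<lambda>(a, b). (- a, b)) ys) = - sum_tens2 scale ys"
    by (induction ys) (auto simp: sum_tens2_def tens2_def fun_eq_iff neg)
  then have "t - t' = sum_tens2 scale (xs @ map (\<lambda>(a, b). (- a, b)) ys)"
    by (simp add: t t' sum_tens2_def)
  then show ?thesis by (simp add: tensor_square_def)
qed

lemma map_tens2_in_tensor_square:
  assumes "Vector_Spaces.linear scale scale \<phi>" "Vector_Spaces.linear scale scale \<psi>"
    and "t \<in> tensor_square scale"
  shows "map_tens2 scale \<phi> \<psi> t \<in> tensor_square scale"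
proof -
  obtain xs where t: "t = sum_tens2 scale xs"
    using assms by (auto simp: tensor_square_def)
  have "map_tens2 scale \<phi> \<psi> t = sum_tens2 scale (map (\<lambda>(a, b). (\<phi> a, \<psi> b)) xs)"
    unfolding t map_tens2_sum_tens2[OF assms(1,2)]
    by (simp add: sum_tens2_def comp_def case_prod_unfold)
  then show ?thesis by (simp add: tensor_square_def)
qed

text \<open>Expansion in the dual basis, stated between functions because a linear map on the dual
  is later applied to the sum itself.\<close>

lemma dual_expansion:
  assumes "f \<in> dual scale"
  shows "f = (\<Sum>b\<in>Basis. (\<lambda>x. f b * representation Basis x b))"
proof
  fix x
  have "f 0 = 0" using dual_scale[OF assms, of 0 0] by simp
  then have "f (\<Sum>b\<in>S. scale (c b) b) = (\<Sum>b\<in>S. f b * c b)" for S c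
    by (induction S rule: infinite_finite_induct)
      (auto simp: dual_add[OF assms] dual_scale[OF assms])
  then have "f (\<Sum>b\<in>Basis. scale (representation Basis x b) b)
      = (\<Sum>b\<in>Basis. f b * representation Basis x b)" .
  moreover have "(\<Sum>b\<in>Basis. scale (representation Basis x b) b) = x"
    using sum_representation_eq[OF independent_Basis _ finite_Basis order_refl] span_Basis by simp
  moreover have "(\<Sum>b\<in>S. (\<lambda>x. f b * representation Basis x b)) x
      = (\<Sum>b\<in>S. f b * representation Basis x b)" for S
    by (induction S rule: infinite_finite_induct) auto
  ultimately show "f x = (\<Sum>b\<in>Basis. (\<lambda>x. f b * representation Basis x b)) x"
    by simp
qed

lemma dual_closed:
  shows "(0 :: 'b \<Rightarrow> 'a) \<in> dual scale"
    and "f \<in> dual scale \<Longrightarrow> g \<in> dual scale \<Longrightarrow> f + g \<in> dual scale"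
    and "f \<in> dual scale \<Longrightarrow> (\<lambda>x. c * f x) \<in> dual scale"
  unfolding dual_def Vector_Spaces.linear_iff
  by (auto simp: vector_space_axioms vector_space_field algebra_simps)

text \<open>Counterpart of \<open>operator_form_inject\<close>: every linear map from the dual to
  the space comes from a tensor. Linearity is asked only on the dual, since \<open>T\<close> is
  arbitrary elsewhere on the function type.\<close>

lemma operator_form_surj:
  assumes add: "\<And>f g. f \<in> dual scale \<Longrightarrow> g \<in> dual scale \<Longrightarrow> T (f + g) = T f + T g"
    and scl: "\<And>c f. f \<in> dual scale \<Longrightarrow> T (\<lambda>x. c * f x) = scale c (T f)"
  shows "\<exists>r\<in>tensor_square scale. \<forall>f\<in>dual scale. operator_form scale r f = T f"
proof -
  define e where "e = (\<lambda>b x. representation Basis x b)"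
  have e: "e b \<in> dual scale" if "b \<in> Basis" for b
    using coordinate_in_dual[OF that] by (simp add: e_def)
  obtain bs where bs: "set bs = Basis" "distinct bs"
    using finite_distinct_list[OF finite_Basis] by blast
  \<comment> \<open>The witness is the sum of \<open>b \<otimes> T (e b)\<close>; contracting its
    first factor with \<open>f\<close> gives the sum of \<open>f b\<close> times
    \<open>T (e b)\<close>, which is \<open>T f\<close>.\<close>
  define r where "r = sum_tens2 scale (map (\<lambda>b. (b, T (e b))) bs)"
  have "operator_form scale r f = T f" if f: "f \<in> dual scale" for f
  proof -
    have T0: "T 0 = 0" using add[OF dual_closed(1) dual_closed(1)] by simp
    \<comment> \<open>Membership in the dual is carried through the induction because additivity of
      \<open>T\<close> may be used only there.\<close>
    have "(\<Sum>b\<in>S. (\<lambda>x. f b * e b x)) \<in> dual scale \<and>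
        T (\<Sum>b\<in>S. (\<lambda>x. f b * e b x)) = (\<Sum>b\<in>S. scale (f b) (T (e b)))"
      if "finite S" "S \<subseteq> Basis" for S
      using that
    proof (induction S rule: finite_induct)
      case empty
      then show ?case using dual_closed(1) T0 by (simp add: zero_fun_def)
    next
      case (insert b S)
      then have b: "(\<lambda>x. f b * e b x) \<in> dual scale" using dual_closed(3) e by simp
      then show ?case using insert dual_closed(2)[OF b] add[OF b] scl[OF e]
        by (simp add: plus_fun_def)
    qed
    from this[OF finite_Basis order_refl] have "T f = (\<Sum>b\<in>Basis. scale (f b) (T (e b)))"
      using dual_expansion[OF f] by (simp add: e_def)
    moreover have "operator_form scale r f = (\<Sum>b\<leftarrow>bs. scale (f b) (T (e b)))"
      using operator_form_eq(1)[OF r_def f] by (simp add: comp_def)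
    ultimately show ?thesis
      using sum_list_distinct_conv_sum_set[OF bs(2), of "\<lambda>b. scale (f b) (T (e b))"] bs(1) by simp
  qed
  moreover have "r \<in> tensor_square scale" by (simp add: r_def tensor_square_def)
  ultimately show ?thesis by blast
qed

end

section \<open>Identities of the Leibniz product\<close>

context leibniz_algebra
begin

lemma br_add: "br (x + y) z = br x z + br y z" "br x (y + z) = br x y + br x z"
  and br_scale: "br (s c x) y = s c (br x y)" "br x (s c y) = s c (br x y)"
  using bilinear_br by (auto simp: bilinear_map_def Vector_Spaces.linear_iff)

lemma br_minus: "br (- x) y = - br x y" "br x (- y) = - br x y"
  using br_scale(1)[of "- 1"] br_scale(2)[of _ "- 1"] by auto

lemma linear_br: "Vector_Spaces.linear s s (br x)" "Vector_Spaces.linear s s (\<lambda>y. br y x)"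
  and linear_symm_br: "Vector_Spaces.linear s s (\<lambda>y. br x y + br y x)"
  unfolding Vector_Spaces.linear_iff
  by (auto simp: br_add br_scale vector_space_axioms scale_right_distrib)

text \<open>By the Leibniz identity, \<open>br (br x y) z\<close> is the commutator of the left
  multiplications by \<open>x\<close> and \<open>y\<close> applied to \<open>z\<close>, hence
  antisymmetric in \<open>x\<close> and \<open>y\<close>.\<close>

lemma br_symm_left: "br (br x y + br y x) z = 0"
  using leibniz[of x y z] leibniz[of y x z] by (simp add: br_add)

end

section \<open>Invariance of the form and the identification of the algebra with its dual\<close>

context skew_quadratic_leibniz_algebra
begin

lemma form_add: "\<omega> (x + y) z = \<omega> x z + \<omega> y z" "\<omega> x (y + z) = \<omega> x y + \<omega> x z"
  and form_scale: "\<omega> (s c x) y = c * \<omega> x y" "\<omega> x (s c y) = c * \<omega> x y"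
  using bilinear_form by (auto simp: bilinear_map_def Vector_Spaces.linear_iff)

lemma form_minus: "\<omega> (- x) y = - \<omega> x y" "\<omega> x (- y) = - \<omega> x y"
  using form_scale(1)[of "- 1"] form_scale(2)[of _ "- 1"] by auto

lemma form_diff: "\<omega> (x - y) z = \<omega> x z - \<omega> y z" "\<omega> z (x - y) = \<omega> z x - \<omega> z y"
  using form_add(1)[of "x - y" y z] form_add(2)[of z "x - y" y] by simp_all

lemma form_zero: "\<omega> 0 y = 0" "\<omega> x 0 = 0"
  using form_add(1)[of 0 0] form_add(2)[of _ 0 0] by simp_all

text \<open>Invariance and skewness give
  \<open>\<omega> u (br x y) = - \<omega> x (br u y + br y u)\<close>, which is symmetric in
  \<open>u\<close> and \<open>y\<close>. So \<open>u\<close> and \<open>y\<close> may be exchanged,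
  and skewness gives the claim.\<close>

lemma invariant_left: "\<omega> u (br x y) = - \<omega> (br x u) y"
proof -
  have "\<omega> u (br x y) = - \<omega> x (br u y) - \<omega> x (br y u)"
    using invariant[of u x y] skew[of "br u y + br y u" x] by (simp add: form_add)
  moreover have "\<omega> x (br u y) = - \<omega> u (br x y) - \<omega> u (br y x)"
    using invariant[of x u y] skew[of "br x y + br y x" u] by (simp add: form_add)
  moreover have "\<omega> y (br x u) = - \<omega> x (br y u) - \<omega> x (br u y)"
    using invariant[of y x u] skew[of "br y u + br u y" x] by (simp add: form_add)
  ultimately show ?thesis using skew[of y "br x u"] by simp
qed

text \<open>These rules evaluate \<open>map_tens2\<close> on covectors
  \<open>sharp \<omega> u\<close>. In the third, the two transposes \<open>- br x u\<close> and
  \<open>br u x + br x u\<close> are added and \<open>br x u\<close> cancels.\<close>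

lemma sharp_comp:
  "sharp \<omega> u \<circ> br x = sharp \<omega> (- br x u)"
  "sharp \<omega> u \<circ> (\<lambda>y. br y x) = sharp \<omega> (br u x + br x u)"
  "sharp \<omega> u \<circ> (\<lambda>y. br x y + br y x) = sharp \<omega> (br u x)"
  using invariant_left[of u x] invariant[of u _ x]
  by (auto simp: sharp_def fun_eq_iff form_minus form_add)

lemma sharp_in_dual: "sharp \<omega> u \<in> dual s"
  using bij_sharp by (auto simp: bij_betw_def)

lemma dual_sharpE:
  assumes "f \<in> dual s"
  obtains u where "f = sharp \<omega> u"
  using assms bij_sharp by (auto simp: bij_betw_def)

lemma inv_sharp: "inv (sharp \<omega>) (sharp \<omega> u) = u"
  using bij_sharp by (auto simp: bij_betw_def)

text \<open>As \<open>sharp \<omega>\<close> is onto the dual, tensors can be compared on vectors.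
  Arguments outside the dual need their own premise because equality is that of HOL
  functions.\<close>

lemma tensor2_eqI:
  assumes "\<And>f g. f \<notin> dual s \<or> g \<notin> dual s \<Longrightarrow> t f g = t' f g"
    and "\<And>u v. t (sharp \<omega> u) (sharp \<omega> v) = t' (sharp \<omega> u) (sharp \<omega> v)"
  shows "t = t'"
  by (intro ext) (metis assms dual_sharpE)

lemma tensor3_eqI:
  assumes "\<And>f g h. f \<notin> dual s \<or> g \<notin> dual s \<or> h \<notin> dual s \<Longrightarrow> t f g h = t' f g h"
    and "\<And>u v w. t (sharp \<omega> u) (sharp \<omega> v) (sharp \<omega> w) = t' (sharp \<omega> u) (sharp \<omega> v) (sharp \<omega> w)"
  shows "t = t'"
  by (intro ext) (metis assms dual_sharpE)

end

section \<open>The tensor of the Rota-Baxter operator and the descendent product\<close>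

locale rota_baxter_tensor = skew_quadratic_rota_baxter_leibniz_algebra s Basis br \<omega> \<beta> 0
  for s :: "'k::{alg_closed_field, field_char_0} \<Rightarrow> 'a::ab_group_add \<Rightarrow> 'a"
    and Basis :: "'a set" and br :: "'a \<Rightarrow> 'a \<Rightarrow> 'a" and \<omega> :: "'a \<Rightarrow> 'a \<Rightarrow> 'k"
    and \<beta> :: "'a \<Rightarrow> 'a" +
  fixes r :: "('a, 'k) tensor2"
  assumes r_in: "r \<in> tensor_square s"
    and r_operator: "f \<in> dual s \<Longrightarrow> operator_form s r f = \<beta> (inv (sharp \<omega>) f)"
begin

text \<open>The descendent product in weight 0; \<open>beta_br\<close> says that
  \<open>\<beta>\<close> is a homomorphism from it to \<open>br\<close>.\<close>

definition desc :: "'a \<Rightarrow> 'a \<Rightarrow> 'a"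
  where "desc u v = br (\<beta> u) v + br u (\<beta> v)"

lemma beta_linear: "Vector_Spaces.linear s s \<beta>"
  and beta_br: "br (\<beta> x) (\<beta> y) = \<beta> (desc x y)"
  using rota_baxter by (auto simp: rota_baxter_operator_def desc_def add.commute)

lemma beta_add: "\<beta> (x + y) = \<beta> x + \<beta> y"
  using beta_linear by (simp add: Vector_Spaces.linear_iff)

lemma beta_scale: "\<beta> (s c x) = s c (\<beta> x)"
  using beta_linear by (simp add: Vector_Spaces.linear_iff)

lemma beta_minus: "\<beta> (- x) = - \<beta> x"
  using beta_scale[of "- 1"] by simp

lemma beta_skew: "\<omega> (\<beta> x) y = - \<omega> x (\<beta> y)"
  using form_compat[of x y] by (simp add: eq_neg_iff_add_eq_0)

lemma r_sharp: "r (sharp \<omega> u) (sharp \<omega> v) = \<omega> v (\<beta> u)"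
proof -
  obtain xs where "r = sum_tens2 s xs" using r_in by (auto simp: tensor_square_def)
  from operator_form_eq(2)[OF this sharp_in_dual, of u] sharp_in_dual
  have "sharp \<omega> v (operator_form s r (sharp \<omega> u)) = r (sharp \<omega> u) (sharp \<omega> v)" by blast
  then show ?thesis by (simp add: r_operator[OF sharp_in_dual] inv_sharp) (simp add: sharp_def)
qed

text \<open>In \<open>r_sharp\<close>, the form \<open>\<omega> v (\<beta> u)\<close> is symmetric
  in \<open>u\<close> and \<open>v\<close>: the sign from the skewness of \<open>\<beta>\<close>
  cancels the one from the skewness of \<open>\<omega>\<close>.\<close>

lemma r_flip: "flip r = r"
proof (rule tensor2_eqI)
  show "flip r f g = r f g" if "f \<notin> dual s \<or> g \<notin> dual s" for f g
    using that tensor_square_outside[OF r_in] by (auto simp: flip_def)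
  show "flip r (sharp \<omega> u) (sharp \<omega> v) = r (sharp \<omega> u) (sharp \<omega> v)" for u v
    using beta_skew[of v u] skew[of u "\<beta> v"] by (simp add: flip_def r_sharp)
qed

lemma desc_minus: "desc (- x) z = - desc x z" "desc x (- z) = - desc x z"
  by (simp_all add: desc_def br_minus beta_minus)

text \<open>After \<open>beta_br\<close> removes the outer \<open>\<beta>\<close> from inner
  products, the identity is the sum of three Leibniz identities, each with \<open>\<beta>\<close> on
  two of \<open>u\<close>, \<open>v\<close>, \<open>w\<close>.\<close>

lemma desc_leibniz: "desc (desc u v) w + desc v (desc u w) = desc u (desc v w)"
proof -
  have "desc (desc u v) w = br (br (\<beta> u) (\<beta> v)) w + br (desc u v) (\<beta> w)"
    "desc v (desc u w) = br (\<beta> v) (desc u w) + br v (br (\<beta> u) (\<beta> w))"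
    "desc u (desc v w) = br (\<beta> u) (desc v w) + br u (br (\<beta> v) (\<beta> w))"
    unfolding desc_def[of "desc u v"] desc_def[of v "desc u w"] desc_def[of u "desc v w"]
    by (simp_all add: beta_br)
  moreover note leibniz[of "\<beta> u" "\<beta> v" w] leibniz[of "\<beta> u" v "\<beta> w"] leibniz[of u "\<beta> v" "\<beta> w"]
  ultimately show ?thesis by (simp add: desc_def br_add algebra_simps)
qed

section \<open>The coboundary as a comultiplication\<close>

lemma coboundary_sharp:
  "coboundary s br r x (sharp \<omega> u) (sharp \<omega> v) = \<omega> (desc u v) x"
proof -
  have "coboundary s br r x (sharp \<omega> u) (sharp \<omega> v)
      = \<omega> v (\<beta> (br u x)) - \<omega> (br v x + br x v) (\<beta> u)"
    by (simp add: coboundary_def F_op_def map_tens2_def sharp_in_dual sharp_comp r_sharp)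
  \<comment> \<open>Skewness moves \<open>\<beta>\<close> to \<open>v\<close> in the first term and
    invariance restores a bracket in the second; \<open>invariant_left\<close> then isolates
    \<open>x\<close> in both.\<close>
  also have "\<dots> = - \<omega> (\<beta> v) (br u x) - \<omega> v (br (\<beta> u) x)"
    using beta_skew[of v "br u x"] invariant[of v "\<beta> u" x] by simp
  also have "\<dots> = \<omega> (desc u v) x"
    by (simp add: invariant_left desc_def form_add)
  finally show ?thesis .
qed

lemma coboundary_outside:
  "f \<notin> dual s \<or> g \<notin> dual s \<Longrightarrow> coboundary s br r x f g = 0"
  by (auto simp: coboundary_def F_op_def map_tens2_def)

lemma coboundary_in_tensor_square: "coboundary s br r x \<in> tensor_square s"
proof -
  have "Vector_Spaces.linear s s id"
    by (simp add: Vector_Spaces.linear_iff vector_space_axioms)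
  then show ?thesis
    unfolding coboundary_def F_op_def
    by (intro tensor_square_diff map_tens2_in_tensor_square linear_br linear_symm_br r_in)
qed

lemma coboundary_linear: "Vector_Spaces.linear s scale_tens2 (coboundary s br r)"
proof -
  have "coboundary s br r (x + y) = coboundary s br r x + coboundary s br r y" for x y
    by (rule tensor2_eqI) (simp_all add: coboundary_outside coboundary_sharp form_add)
  moreover have "coboundary s br r (s c x) = scale_tens2 c (coboundary s br r x)" for c x
    by (rule tensor2_eqI)
      (simp_all add: coboundary_outside coboundary_sharp form_scale scale_tens2_def)
  ultimately show ?thesis
    by (simp add: Vector_Spaces.linear_iff vector_space_axioms vector_space_scale_tens2)
qed

text \<open>Contracting a coproduct with two covectors yields the covector of their descendent
  product, so iterated coproducts become iterated products.\<close>

lemma coboundary_transpose: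
  "(\<lambda>x. coboundary s br r x (sharp \<omega> u) (sharp \<omega> v)) = sharp \<omega> (desc u v)"
  unfolding coboundary_sharp by (simp add: sharp_def)

text \<open>On \<open>u\<close>, \<open>v\<close>, \<open>w\<close> the three terms pair
  \<open>x\<close> with \<open>desc (desc u v) w\<close>, \<open>desc v (desc u w)\<close> and
  \<open>desc u (desc v w)\<close>, so \<open>desc_leibniz\<close> applies.\<close>

lemma coboundary_co_leibniz:
  defines "\<Delta> \<equiv> coboundary s br r"
  shows "comul_id s \<Delta> (\<Delta> x) + flip_id (id_comul s \<Delta> (\<Delta> x)) - id_comul s \<Delta> (\<Delta> x) = 0"
proof (rule tensor3_eqI)
  fix u v w
  have "\<omega> (desc (desc u v) w) x + \<omega> (desc v (desc u w)) x = \<omega> (desc u (desc v w)) x"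
    by (simp add: desc_leibniz flip: form_add)
  then show "(comul_id s \<Delta> (\<Delta> x) + flip_id (id_comul s \<Delta> (\<Delta> x)) - id_comul s \<Delta> (\<Delta> x))
      (sharp \<omega> u) (sharp \<omega> v) (sharp \<omega> w) = 0 (sharp \<omega> u) (sharp \<omega> v) (sharp \<omega> w)"
    by (simp add: \<Delta>_def comul_id_def id_comul_def flip_id_def sharp_in_dual
        coboundary_transpose) (simp add: coboundary_sharp)
qed (auto simp: comul_id_def id_comul_def flip_id_def)

section \<open>The two compatibility conditions\<close>

lemma desc_symm_form:
  "\<omega> (desc (br v y + br y v) u) x = - \<omega> (br x u + br u x) (\<beta> (br v y + br y v))"
proof -
  \<comment> \<open>Only one summand of \<open>desc\<close> survives, since symmetrised brackets
    multiply from the left by zero.\<close>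
  have "desc (br v y + br y v) u = br (\<beta> (br v y + br y v)) u"
    by (simp add: desc_def br_symm_left)
  then show ?thesis using skew[of "br (\<beta> (br v y + br y v)) u" x] invariant[of x "\<beta> (br v y + br y v)" u]
    by simp
qed

text \<open>By \<open>desc_symm_form\<close> both sides are values of the form
  \<open>- \<omega> a (\<beta> b)\<close> at the symmetrised brackets of \<open>x, u\<close> and of
  \<open>v, y\<close>, in opposite orders; this form is symmetric.\<close>

lemma coboundary_compat1:
  "flip (map_tens2 s (\<lambda>z. br z y) id (coboundary s br r x))
    = map_tens2 s (\<lambda>z. br z x) id (coboundary s br r y)"
proof (rule tensor2_eqI)
  fix u v
  have "\<omega> (br x u + br u x) (\<beta> (br v y + br y v)) = \<omega> (br y v + br v y) (\<beta> (br u x + br x u))"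
    using beta_skew[of "br x u + br u x" "br v y + br y v"]
      skew[of "\<beta> (br x u + br u x)" "br v y + br y v"]
    by (simp add: add.commute)
  then show "flip (map_tens2 s (\<lambda>z. br z y) id (coboundary s br r x)) (sharp \<omega> u) (sharp \<omega> v)
      = map_tens2 s (\<lambda>z. br z x) id (coboundary s br r y) (sharp \<omega> u) (sharp \<omega> v)"
    by (simp add: flip_def map_tens2_def sharp_in_dual sharp_comp coboundary_sharp desc_symm_form)
qed (auto simp: flip_def map_tens2_def)

text \<open>The second compatibility condition evaluated on \<open>u\<close> and \<open>v\<close>.
  Invariance rewrites every term as a pairing with \<open>x\<close>; what remains is an identity in
  the algebra for the symmetrised bracket of \<open>desc u v\<close> and \<open>y\<close>.\<close>

lemma desc_form_br:
  "\<omega> (desc u v) (br x y) =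
    \<omega> (desc u (br v y + br y v) + desc (br v y + br y v) u - desc (br u y) v - desc v (br u y)) x
    - \<omega> (desc u (br x v) + desc (br x u) v) y"
proof -
  define S where "S = (\<lambda>a b. br a b + br b a)"
  have inv: "\<omega> a (br x b) = \<omega> (S a b) x" for a b
    using invariant[of a x b] by (simp add: S_def)
  have R: "\<omega> (br a b) y = - \<omega> (S y b) a" for a b
    using invariant[of y a b] skew[of "br a b" y] by (simp add: S_def)
  have L: "\<omega> (br a b) y = \<omega> (br a y) b" for a b
    using invariant_left[of y a b] skew[of "br a b" y] by simp
  \<comment> \<open>The four summands of the pairing with \<open>y\<close>. In \<open>t2\<close> and
    \<open>t3\<close> the operator sits on a bracket containing \<open>x\<close>, so its skewness is
    used before invariance.\<close>
  have t1: "\<omega> (br (\<beta> u) (br x v)) y = \<omega> (S (br (\<beta> u) y) v) x"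
    using L inv by simp
  have t2: "\<omega> (br u (\<beta> (br x v))) y = - \<omega> (S (\<beta> (br u y)) v) x"
    using L inv beta_skew[of "br u y" "br x v"] by simp
  have t3: "\<omega> (br (\<beta> (br x u)) v) y = \<omega> (S (\<beta> (S y v)) u) x"
    using R inv beta_skew[of "S y v" "br x u"] by simp
  have t4: "\<omega> (br (br x u) (\<beta> v)) y = - \<omega> (S (S y (\<beta> v)) u) x"
    using R inv by simp
  have symm: "S a b = S b a" "br (S a b) c = 0" for a b c
    by (simp_all add: S_def add.commute br_symm_left)
  \<comment> \<open>Left multiplications are derivations of \<open>br\<close>, hence also of its
    symmetrisation.\<close>
  have der: "br a (S b c) = S (br a b) c + S b (br a c)" for a b c
    using leibniz[of a b c] leibniz[of a c b] by (simp add: S_def br_add)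
  have S_add: "S (a + b) c = S a c + S b c" "S a (b + c) = S a b + S a c" for a b c
    by (simp_all add: S_def br_add algebra_simps)
  have "S (desc u v) y = S (br (\<beta> u) v) y + S (br u (\<beta> v)) y"
    by (simp add: desc_def S_add)
  also have "\<dots> = br (\<beta> u) (S v y) - S v (br (\<beta> u) y) + (br u (S (\<beta> v) y) - S (\<beta> v) (br u y))"
    by (simp add: der)
  \<comment> \<open>The terms \<open>S (\<beta> (br u y)) v\<close> and
    \<open>S (\<beta> (S y v)) u\<close> are added and subtracted to complete the products
    \<open>desc\<close>. Since \<open>S y (\<beta> v)\<close> multiplies from the left by zero,
    \<open>S (S y (\<beta> v)) u\<close> is just \<open>br u (S y (\<beta> v))\<close>.\<close>
  also have "\<dots> = (desc u (S v y) + desc (S v y) u - desc (br u y) v - desc v (br u y))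
      - (S (br (\<beta> u) y) v - S (\<beta> (br u y)) v + S (\<beta> (S y v)) u - S (S y (\<beta> v)) u)"
    unfolding desc_def symm(2)
    using symm(1)[of "\<beta> v" y] symm(1)[of v y] symm(1)[of v "br (\<beta> u) y"] symm(2)[of y "\<beta> v" u]
    by (simp add: S_def algebra_simps)
  finally have "\<omega> (desc u v) (br x y) =
    \<omega> (desc u (S v y) + desc (S v y) u - desc (br u y) v - desc v (br u y)) x
    - \<omega> (S (br (\<beta> u) y) v - S (\<beta> (br u y)) v + S (\<beta> (S y v)) u - S (S y (\<beta> v)) u) x"
    by (simp only: inv form_diff)
  moreover have "\<omega> (desc u (br x v) + desc (br x u) v) y =
    \<omega> (S (br (\<beta> u) y) v - S (\<beta> (br u y)) v + S (\<beta> (S y v)) u - S (S y (\<beta> v)) u) x"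
    unfolding desc_def form_add t1 t2 t3 t4
    by (simp add: form_add form_diff)
  ultimately show ?thesis by (simp add: S_def)
qed

lemma coboundary_compat2:
  defines "\<Delta> \<equiv> coboundary s br r"
  shows "\<Delta> (br x y) =
      map_tens2 s id (\<lambda>z. br z y) (\<Delta> x + flip (\<Delta> x))
      - map_tens2 s (\<lambda>z. br y z + br z y) id (\<Delta> x + flip (\<Delta> x))
      + (map_tens2 s id (br x) (\<Delta> y) + map_tens2 s (br x) id (\<Delta> y))"
    (is "_ = ?rhs")
proof (rule tensor2_eqI)
  fix u v
  have "?rhs (sharp \<omega> u) (sharp \<omega> v)
      = \<omega> (desc u (br v y + br y v)) x + \<omega> (desc (br v y + br y v) u) x
        - (\<omega> (desc (br u y) v) x + \<omega> (desc v (br u y)) x)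
        + (\<omega> (desc u (- br x v)) y + \<omega> (desc (- br x u) v) y)"
    by (simp add: \<Delta>_def map_tens2_def flip_def sharp_in_dual sharp_comp coboundary_sharp)
  then show "\<Delta> (br x y) (sharp \<omega> u) (sharp \<omega> v) = ?rhs (sharp \<omega> u) (sharp \<omega> v)"
    unfolding \<Delta>_def coboundary_sharp desc_form_br
    by (simp add: form_add form_diff desc_minus form_minus)
qed (auto simp: \<Delta>_def map_tens2_def coboundary_outside)

section \<open>The classical Leibniz Yang-Baxter equation\<close>

lemma r_clybe: "double_bracket s br r = 0"
proof -
  obtain xs where r: "r = sum_tens2 s xs" using r_in by (auto simp: tensor_square_def)
  \<comment> \<open>By symmetry the swapped list also presents \<open>r\<close>, so contracting
    either factor of \<open>r\<close> with \<open>sharp \<omega> u\<close> gives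
    \<open>\<beta> u\<close>.\<close>
  have rflip: "r = sum_tens2 s (map (\<lambda>(a, b). (b, a)) xs)"
    using flip_sum_tens2[of xs] r_flip
    by (simp add: r sum_tens2_def comp_def case_prod_unfold)
  have T1: "(\<Sum>p\<leftarrow>xs. s (\<omega> u (fst p)) (snd p)) = \<beta> u" for u
    using operator_form_eq(1)[OF r sharp_in_dual[of u]]
    by (simp add: r_operator sharp_in_dual inv_sharp case_prod_unfold) (simp add: sharp_def)
  have T2: "(\<Sum>p\<leftarrow>xs. s (\<omega> u (snd p)) (fst p)) = \<beta> u" for u
    using operator_form_eq(1)[OF rflip sharp_in_dual[of u]]
    by (simp add: r_operator sharp_in_dual inv_sharp comp_def case_prod_unfold) (simp add: sharp_def)
  \<comment> \<open>In each term of the double bracket, one factor of each copy of \<open>r\<close>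
    is contracted and the other two are bracketed; bilinearity moves both sums inside the
    bracket.\<close>
  have double_sum: "C (\<Sum>p\<leftarrow>xs. s (f p) (F p)) (\<Sum>q\<leftarrow>ys. s (g q) (G q))
      = (\<Sum>p\<leftarrow>xs. \<Sum>q\<leftarrow>ys. f p * g q * C (F p) (G q))"
    if C: "bilinear_map s (*) C" for C f g and F G :: "'a \<times> 'a \<Rightarrow> 'a" and xs ys
  proof -
    have C_add: "C (x + y) z = C x z + C y z" "C x (y + z) = C x y + C x z"
      and C_scale: "C (s c x) y = c * C x y" "C x (s c y) = c * C x y" for c x y z
      using C by (auto simp: bilinear_map_def Vector_Spaces.linear_iff)
    have C_zero: "C 0 y = 0" "C x 0 = 0" for x y
      using C_add(1)[of 0 0] C_add(2)[of _ 0 0] by simp_all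
    have "C x (\<Sum>q\<leftarrow>ys. s (g q) (G q)) = (\<Sum>q\<leftarrow>ys. g q * C x (G q))" for x
      by (induction ys) (simp_all add: C_zero C_add C_scale)
    then show ?thesis
      by (induction xs)
        (simp_all add: C_zero C_add C_scale mult_ac distrib_left sum_list_addf
          flip: sum_list_const_mult)
  qed
  show ?thesis
    unfolding double_bracket_eq[OF bilinear_br r]
  proof (rule tensor3_eqI)
    fix u v w
    have "double_bracket_sum s br xs (sharp \<omega> u) (sharp \<omega> v) (sharp \<omega> w)
      = (\<Sum>p\<leftarrow>xs. \<Sum>q\<leftarrow>xs.
          \<omega> u (br (fst p) (fst q)) * \<omega> v (snd p) * \<omega> w (snd q)
          - \<omega> u (fst p) * \<omega> v (br (snd p) (fst q) + br (fst q) (snd p)) * \<omega> w (snd q)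
          + \<omega> u (fst p) * \<omega> v (fst q) * \<omega> w (br (snd q) (snd p)))"
      unfolding double_bracket_sum_def sum_list_pair_fun_apply
      by (simp add: tens3_def sharp_in_dual) (simp add: sharp_def case_prod_unfold)
    also have "\<dots> = \<omega> u (br (\<beta> v) (\<beta> w)) - \<omega> v (br (\<beta> u) (\<beta> w) + br (\<beta> w) (\<beta> u))
        + \<omega> w (br (\<beta> v) (\<beta> u))"
    proof -
      note bilI = bilinear_mapI[OF vector_space_axioms vector_space_field]
      note lin_simps = br_add br_scale form_add form_scale distrib_left
      have "bilinear_map s (*) (\<lambda>x y. \<omega> u (br x y))"
        by (rule bilI) (simp_all add: lin_simps)
      note double_sum[OF this, of "\<lambda>p. \<omega> v (snd p)" fst xs "\<lambda>q. \<omega> w (snd q)" fst xs]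
      then have "\<omega> u (br (\<beta> v) (\<beta> w))
          = (\<Sum>p\<leftarrow>xs. \<Sum>q\<leftarrow>xs. \<omega> u (br (fst p) (fst q)) * \<omega> v (snd p) * \<omega> w (snd q))"
        using T2 by (simp add: mult_ac)
      moreover have "bilinear_map s (*) (\<lambda>x y. \<omega> v (br x y + br y x))"
        by (rule bilI) (simp_all add: lin_simps)
      note double_sum[OF this, of "\<lambda>p. \<omega> u (fst p)" snd xs "\<lambda>q. \<omega> w (snd q)" fst xs]
      then have "\<omega> v (br (\<beta> u) (\<beta> w) + br (\<beta> w) (\<beta> u))
          = (\<Sum>p\<leftarrow>xs. \<Sum>q\<leftarrow>xs.
              \<omega> u (fst p) * \<omega> v (br (snd p) (fst q) + br (fst q) (snd p)) * \<omega> w (snd q))"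
        using T1 T2 by (simp add: mult_ac)
      moreover have "bilinear_map s (*) (\<lambda>x y. \<omega> w (br y x))"
        by (rule bilI) (simp_all add: lin_simps)
      note double_sum[OF this,
          where f = "\<lambda>p. \<omega> u (fst p)" and F = snd and xs = xs
          and g = "\<lambda>q. \<omega> v (fst q)" and G = snd and ys = xs]
      then have "\<omega> w (br (\<beta> v) (\<beta> u))
          = (\<Sum>p\<leftarrow>xs. \<Sum>q\<leftarrow>xs. \<omega> u (fst p) * \<omega> v (fst q) * \<omega> w (br (snd q) (snd p)))"
        using T1 by (simp add: mult_ac)
      ultimately show ?thesis by (simp add: sum_list_addf sum_list_subtractf)
    qed
    \<comment> \<open>All three terms are turned into pairings with \<open>w\<close>: the first two
      give the two summands of \<open>\<beta> (desc v u)\<close>, and the difference vanishes by the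
      Rota-Baxter identity.\<close>
    also have "\<dots> = \<omega> w (br (\<beta> v) (\<beta> u) - \<beta> (desc v u))"
    proof -
      have "\<omega> u (br (\<beta> v) (\<beta> w)) = - \<omega> w (\<beta> (br (\<beta> v) u))"
        using invariant_left[of u "\<beta> v" "\<beta> w"] beta_skew[of "br (\<beta> v) u" w]
          skew[of "\<beta> (br (\<beta> v) u)" w] by simp
      moreover have "\<omega> v (br (\<beta> u) (\<beta> w) + br (\<beta> w) (\<beta> u)) = \<omega> (br v (\<beta> u)) (\<beta> w)"
        using sharp_comp(3)[of v "\<beta> u"] by (simp add: sharp_def fun_eq_iff)
      moreover have "\<omega> (br v (\<beta> u)) (\<beta> w) = \<omega> w (\<beta> (br v (\<beta> u)))"
        using beta_skew[of "br v (\<beta> u)" w] skew[of "\<beta> (br v (\<beta> u))" w] by simp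
      ultimately show ?thesis
        by (simp only: desc_def beta_add form_add form_diff) simp
    qed
    also have "\<dots> = 0" by (simp add: beta_br form_zero)
    finally show "double_bracket_sum s br xs (sharp \<omega> u) (sharp \<omega> v) (sharp \<omega> w)
        = 0 (sharp \<omega> u) (sharp \<omega> v) (sharp \<omega> w)" by simp
  next
    fix f g h
    assume "f \<notin> dual s \<or> g \<notin> dual s \<or> h \<notin> dual s"
    then have "tens3 s a b c f g h = 0" for a b c by (auto simp: tens3_def)
    then show "double_bracket_sum s br xs f g h = 0 f g h"
      by (simp add: double_bracket_sum_def sum_list_pair_fun_apply sum_list_pair_0)
  qed
qed

section \<open>The triangular bialgebra and the existence of its tensor\<close>

lemma triangular: "triangular_leibniz_bialgebra s Basis br r"
  by (intro triangular_leibniz_bialgebra.intro triangular_leibniz_bialgebra_axioms.intro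
      leibniz_bialgebra.intro leibniz_bialgebra_axioms.intro leibniz_algebra_axioms
      coboundary_in_tensor_square coboundary_linear coboundary_co_leibniz coboundary_compat1
      coboundary_compat2 r_in r_flip r_clybe)

end

theorem corollary4p18:
  fixes s :: "'k::{alg_closed_field, field_char_0} \<Rightarrow> 'a::ab_group_add \<Rightarrow> 'a"
    and Basis :: "'a set" and br :: "'a \<Rightarrow> 'a \<Rightarrow> 'a"
    and \<omega> :: "'a \<Rightarrow> 'a \<Rightarrow> 'k" and \<beta> :: "'a \<Rightarrow> 'a"
  assumes "skew_quadratic_rota_baxter_leibniz_algebra s Basis br \<omega> \<beta> 0"
  shows "\<exists>r \<in> tensor_square s.
      (\<forall>f \<in> dual s. operator_form s r f = \<beta> (inv (sharp \<omega>) f)) \<and>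
      triangular_leibniz_bialgebra s Basis br r"
proof -
  interpret skew_quadratic_rota_baxter_leibniz_algebra s Basis br \<omega> \<beta> 0 by fact
  have lin: "Vector_Spaces.linear s s \<beta>"
    using rota_baxter by (simp add: rota_baxter_operator_def)
  have "\<exists>r\<in>tensor_square s. \<forall>f\<in>dual s. operator_form s r f = \<beta> (inv (sharp \<omega>) f)"
  proof (rule operator_form_surj)
    fix f g assume "f \<in> dual s" "g \<in> dual s"
    \<comment> \<open>The inverse of \<open>sharp \<omega>\<close> is controlled only on the dual,
      so covectors are first written as images of vectors.\<close>
    then obtain u v where uv: "f = sharp \<omega> u" "g = sharp \<omega> v" by (metis dual_sharpE)
    then have "f + g = sharp \<omega> (u + v)" by (simp add: sharp_def fun_eq_iff form_add)
    then show "\<beta> (inv (sharp \<omega>) (f + g)) = \<beta> (inv (sharp \<omega>) f) + \<beta> (inv (sharp \<omega>) g)"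
      using lin by (simp add: uv inv_sharp Vector_Spaces.linear_iff)
  next
    fix c f assume "f \<in> dual s"
    then obtain u where u: "f = sharp \<omega> u" by (metis dual_sharpE)
    then have "(\<lambda>x. c * f x) = sharp \<omega> (s c u)" by (simp add: sharp_def fun_eq_iff form_scale)
    then show "\<beta> (inv (sharp \<omega>) (\<lambda>x. c * f x)) = s c (\<beta> (inv (sharp \<omega>) f))"
      using lin by (simp add: u inv_sharp Vector_Spaces.linear_iff)
  qed
  then obtain r where r: "r \<in> tensor_square s"
    and op: "\<forall>f\<in>dual s. operator_form s r f = \<beta> (inv (sharp \<omega>) f)" by blast
  interpret rota_baxter_tensor s Basis br \<omega> \<beta> r
    by unfold_locales (use r op in auto)
  show ?thesis using r op triangular by blast
qed

end
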